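(* Let $p$ be a prime, and suppose that the power series $$\frac{1}{(q)_{\infty}}\left(h(q)-p\,h(q^{p})\right)$$ has positive coefficients for all positive powers of $q$ (that is, the coefficient of $q^n$ is strictly positive for every integer $n\ge 1$). Then for every integer $m\geq 2$, the power series $$\frac{1}{(q)_{\infty}}\left(h(q)-p^{m}h(q^{p^{m}})\right)$$ has positive coefficients for all positive powers of $q$ (that is, the coefficient of $q^n$ is strictly positive for every integer $n\ge 1$).
   Context: All series are formal power series in $q$ (equivalently, convergent series for $|q|<1$). The notation is $(a)_\infty=(a;q)_\infty=\prod_{n=1}^{\infty}(1-aq^{n-1})$, so $(q)_\infty=\prod_{n=1}^{\infty}(1-q^n)$. The function $h$ is defined by $$h(q)=\sum_{n=1}^{\infty}\frac{(-1)^{n+1}q^{n(n+1)/2}}{1-q^n},$$ and $h(q^k)$ denotes the series obtained by substituting $q^k$ for $q$ in $h(q)$. *)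

theory Defs
  imports
    "HOL-Computational_Algebra.Formal_Power_Series"
    "HOL-Computational_Algebra.Primes"
    "HOL-Analysis.Infinite_Products"
begin

text \<open>
  The variable \<open>q\<close> is \<^const>\<open>fps_X\<close>. Infinite sums and products of formal power series are
  \<^const>\<open>suminf\<close> and \<^const>\<open>prodinf\<close> with respect to the \<open>X\<close>-adic metric; the lemmas below show
  that the ones used here converge.
\<close>

definition qpochhammer_inf :: "real fps \<Rightarrow> real fps"
  where "qpochhammer_inf a = (\<Prod>n. 1 - a * fps_X ^ n)"

text \<open>The sum defining \<open>h\<close> starts at \<open>n = 1\<close>, hence the shift by \<^const>\<open>Suc\<close>.\<close>

definition h_term :: "nat \<Rightarrow> real fps"
  where "h_term n = (- 1) ^ (n + 1) * fps_X ^ (n * (n + 1) div 2) / (1 - fps_X ^ n)"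

definition h :: "real fps"
  where "h = (\<Sum>n. h_term (Suc n))"

lemma fps_stable_imp_tendsto:
  fixes s :: "nat \<Rightarrow> real fps"
  assumes "\<And>n k. k < n \<Longrightarrow> fps_nth (s (Suc n)) k = fps_nth (s n) k"
  shows "s \<longlonglongrightarrow> Abs_fps (\<lambda>k. fps_nth (s (Suc k)) k)"
proof (rule tendsto_fpsI)
  fix k
  have "fps_nth (s n) k = fps_nth (s (Suc k)) k" if "n \<ge> Suc k" for n
    using that
  proof (induction n rule: dec_induct)
    case (step n)
    then show ?case
      using assms[of k n] by simp
  qed simp
  then show "\<forall>\<^sub>F n in sequentially.
      fps_nth (s n) k = fps_nth (Abs_fps (\<lambda>k. fps_nth (s (Suc k)) k)) k"
    unfolding eventually_sequentially fps_nth_Abs_fps by blast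
qed

lemma has_prod_qpochhammer_inf:
  assumes "fps_nth a 0 = 0"
  shows "(\<lambda>n. 1 - a * fps_X ^ n) has_prod qpochhammer_inf a"
proof -
  define s where "s = (\<lambda>n. \<Prod>i\<le>n. 1 - a * fps_X ^ i)"
  define l where "l = Abs_fps (\<lambda>k. fps_nth (s (Suc k)) k)"
  have "fps_nth (s (Suc n)) k = fps_nth (s n) k" if "k < n" for n k
  proof -
    have "s (Suc n) = s n - fps_X ^ Suc n * (s n * a)"
      by (simp add: s_def algebra_simps)
    then show ?thesis
      using that by (simp only: fps_sub_nth fps_X_power_mult_nth) simp
  qed
  then have lim: "s \<longlonglongrightarrow> l"
    unfolding l_def by (rule fps_stable_imp_tendsto)
  have "fps_nth (s n) 0 = 1" for n
    unfolding s_def by (induction n) (simp_all add: assms)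
  then have "fps_nth l 0 = 1"
    by (simp add: l_def)
  then have "l \<noteq> 0"
    by auto
  with lim have "(\<lambda>n. 1 - a * fps_X ^ n) has_prod l"
    unfolding has_prod_def raw_has_prod_def s_def by simp
  then show ?thesis
    unfolding qpochhammer_inf_def by (simp flip: has_prod_unique)
qed

lemma h_sums: "(\<lambda>n. h_term (Suc n)) sums h"
proof -
  have "fps_nth (h_term (Suc n)) k = 0" if "k < n" for n k
  proof -
    have "n \<le> Suc n * (Suc n + 1) div 2"
      by (simp add: less_eq_div_iff_mult_less_eq)
    then have "k < Suc n * (Suc n + 1) div 2"
      using that by linarith
    moreover have u: "fps_nth (1 - fps_X ^ Suc n :: real fps) 0 \<noteq> 0"
      by simp
    moreover have "h_term (Suc n) = fps_X ^ (Suc n * (Suc n + 1) div 2) *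
        ((- 1) ^ (Suc n + 1) * inverse (1 - fps_X ^ Suc n))"
      unfolding h_term_def fps_divide_unit[OF u] by (simp only: mult_ac)
    ultimately show ?thesis
      by (simp only: fps_X_power_mult_nth if_True)
  qed
  then have "(\<lambda>n. \<Sum>i<n. h_term (Suc i)) \<longlonglongrightarrow>
      Abs_fps (\<lambda>k. fps_nth (\<Sum>i<Suc k. h_term (Suc i)) k)"
    by (intro fps_stable_imp_tendsto) simp
  then show ?thesis
    unfolding h_def sums_def[symmetric] by (blast intro: summable_sums sums_summable)
qed

end

theory Submission
  imports Defs
begin

text \<open>
  Put \<open>g(q) = h(q) - p h(q\<^sup>p)\<close> and let \<open>E(q)\<close> denote the product \<open>\<Prod>(1 - q\<^sup>n)\<close> over \<open>n \<ge> 1\<close>. The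
  difference in question telescopes: \<open>h(q) - p\<^sup>m h(Q)\<close> with \<open>Q = q ^ (p ^ m)\<close> is the sum of
  \<open>p\<^sup>j g(q ^ (p ^ j))\<close> over \<open>j < m\<close>. After division by \<open>E(q)\<close>, the summand with \<open>j = 0\<close> is
  \<open>g(q) / E(q)\<close>, whose coefficients at positive powers are positive by hypothesis. It is therefore
  enough that all other summands have nonnegative coefficients. With \<open>P = p ^ j\<close>, write
  \[ \frac{g(q^P)}{E(q)} = \frac{E(q^P)}{E(q)} \cdot \frac{g(q^P)}{E(q^P)}. \]
  The second factor is the series \<open>g/E\<close> with \<open>q\<^sup>P\<close> substituted for \<open>q\<close>; its coefficients
  are coefficients of \<open>g/E\<close> or zero, hence nonnegative (the constant one because \<open>h\<close> has no
  constant term). The first factor counts partitions in which each part occurs fewer than \<open>P\<close>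
  times: it is the product of the geometric sums \<open>1 + q\<^sup>n + \<dots>\<close> of length \<open>P\<close>, so its
  coefficients are nonnegative as well (lemma \<open>qpochhammer_quotient_nonneg\<close>).
\<close>

lemma fps_mult_nonneg:
  fixes f g :: "real fps"
  assumes "\<And>n. fps_nth f n \<ge> 0" "\<And>n. fps_nth g n \<ge> 0"
  shows "fps_nth (f * g) n \<ge> 0"
  by (simp add: fps_mult_nth assms sum_nonneg)

lemma fps_prod_nonneg:
  fixes f :: "'a \<Rightarrow> real fps"
  assumes "\<And>i n. i \<in> I \<Longrightarrow> fps_nth (f i) n \<ge> 0"
  shows "fps_nth (prod f I) n \<ge> 0"
  using assms
  by (induction I arbitrary: n rule: infinite_finite_induct) (auto intro!: fps_mult_nonneg)

lemma fps_compose_X_power_nonneg: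
  fixes f :: "real fps"
  assumes "\<And>n. fps_nth f n \<ge> 0"
  shows "fps_nth (f oo fps_X ^ k) n \<ge> 0"
  by (auto simp: fps_compose_nth assms simp flip: power_mult intro!: sum_nonneg mult_nonneg_nonneg)

lemma tendsto_fps_mult:
  fixes f g :: "'b \<Rightarrow> 'a::ring_1 fps"
  assumes "(f \<longlongrightarrow> a) F" "(g \<longlongrightarrow> b) F"
  shows "((\<lambda>x. f x * g x) \<longlongrightarrow> a * b) F"
proof (rule tendsto_fpsI)
  fix n
  have "\<forall>\<^sub>F x in F. \<forall>i\<in>{0..n}. fps_nth (f x) i = fps_nth a i"
       "\<forall>\<^sub>F x in F. \<forall>i\<in>{0..n}. fps_nth (g x) i = fps_nth b i"
    using assms by (simp_all add: eventually_ball_finite tendsto_fps_iff)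
  then show "\<forall>\<^sub>F x in F. fps_nth (f x * g x) n = fps_nth (a * b) n"
    by eventually_elim (simp add: fps_mult_nth)
qed

lemma tendsto_fps_compose:
  fixes f :: "'b \<Rightarrow> 'a::ring_1 fps"
  assumes "(f \<longlongrightarrow> a) F"
  shows "((\<lambda>x. f x oo c) \<longlongrightarrow> a oo c) F"
proof (rule tendsto_fpsI)
  fix n
  have "\<forall>\<^sub>F x in F. \<forall>i\<in>{0..n}. fps_nth (f x) i = fps_nth a i"
    using assms by (simp add: eventually_ball_finite tendsto_fps_iff)
  then show "\<forall>\<^sub>F x in F. fps_nth (f x oo c) n = fps_nth (a oo c) n"
    by eventually_elim (simp add: fps_compose_nth)
qed

lemma tendsto_fps_nonneg:
  fixes f :: "nat \<Rightarrow> real fps"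
  assumes "f \<longlonglongrightarrow> a" "\<And>i n. fps_nth (f i) n \<ge> 0"
  shows "fps_nth a n \<ge> 0"
proof -
  have "\<forall>\<^sub>F i in sequentially. fps_nth (f i) n = fps_nth a n"
    using assms(1) by (simp add: tendsto_fps_iff)
  then obtain i where "fps_nth (f i) n = fps_nth a n"
    using eventually_happens'[OF sequentially_bot] by blast
  with assms(2)[of i n] show ?thesis
    by simp
qed

lemma qpochhammer_inf_X_tendsto:
  "(\<lambda>n. \<Prod>i\<le>n. 1 - fps_X ^ Suc i) \<longlonglongrightarrow> qpochhammer_inf fps_X"
proof -
  have hp: "(\<lambda>n. 1 - fps_X * fps_X ^ n) has_prod qpochhammer_inf fps_X"
    by (rule has_prod_qpochhammer_inf) simp
  have nz: "1 - fps_X * fps_X ^ n \<noteq> (0 :: real fps)" for n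
    by (auto dest: arg_cong[where f = "\<lambda>f. fps_nth f 0"])
  from hp nz have "raw_has_prod (\<lambda>n. 1 - fps_X * fps_X ^ n) 0 (qpochhammer_inf fps_X)"
    unfolding has_prod_def by blast
  then show ?thesis
    by (simp add: raw_has_prod_def)
qed

lemma qpochhammer_inf_X_nth_0: "fps_nth (qpochhammer_inf fps_X) 0 = 1"
proof -
  have "\<forall>\<^sub>F n in sequentially. fps_nth (\<Prod>i\<le>n. 1 - fps_X ^ Suc i) 0
          = fps_nth (qpochhammer_inf fps_X) 0"
    using qpochhammer_inf_X_tendsto unfolding tendsto_fps_iff by blast
  then obtain n where "fps_nth (\<Prod>i\<le>n. 1 - fps_X ^ Suc i) 0
          = fps_nth (qpochhammer_inf fps_X) 0"
    using eventually_happens'[OF sequentially_bot] by blast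
  moreover have "fps_nth (\<Prod>i\<le>n. 1 - fps_X ^ Suc i :: real fps) 0 = 1"
    by (simp add: fps_prod_nth')
  ultimately show ?thesis
    by simp
qed

text \<open>
  Each factor \<open>1 - q\<^sup>n\<close> of the denominator divides the corresponding factor \<open>1 - q ^ (n * k)\<close> of the
  numerator, and the quotient is a geometric sum with coefficients 0 and 1. Passing to the limit
  preserves nonnegativity because every single coefficient is eventually constant.
\<close>

lemma qpochhammer_quotient_nonneg:
  assumes "k > 0"
  shows "fps_nth ((qpochhammer_inf fps_X oo fps_X ^ k) * inverse (qpochhammer_inf fps_X)) n \<ge> 0"
proof (rule tendsto_fps_nonneg)
  let ?s = "\<lambda>n. \<Prod>i\<le>n. 1 - fps_X ^ Suc i :: real fps"
  show "(\<lambda>n. (?s n oo fps_X ^ k) * inverse (?s n)) \<longlonglongrightarrow>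
          (qpochhammer_inf fps_X oo fps_X ^ k) * inverse (qpochhammer_inf fps_X)"
    by (intro tendsto_fps_mult tendsto_fps_compose tendsto_inverse_fps qpochhammer_inf_X_tendsto)
      (simp add: qpochhammer_inf_X_nth_0)
  fix m n
  let ?r = "\<Prod>i\<le>m. \<Sum>j<k. (fps_X ^ Suc i) ^ j :: real fps"
  have X0: "fps_nth (fps_X ^ k :: real fps) 0 = 0"
    using assms by simp
  have factor: "(1 - fps_X ^ Suc i) oo fps_X ^ k =
      (1 - fps_X ^ Suc i) * (\<Sum>j<k. (fps_X ^ Suc i) ^ j :: real fps)" for i
  proof -
    have "(1 - fps_X ^ Suc i :: real fps) oo fps_X ^ k = 1 - (fps_X ^ Suc i) ^ k"
      by (simp only: fps_compose_sub_distrib fps_compose_1 fps_X_power_compose[OF X0]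
          mult.commute flip: power_mult)
    then show ?thesis
      by (simp only: one_diff_power_eq)
  qed
  have s0: "fps_nth (?s m) 0 \<noteq> 0"
    by (simp add: fps_prod_nth')
  have "?s m oo fps_X ^ k = ?s m * ?r"
    unfolding fps_compose_prod_distrib[OF X0] factor by (rule prod.distrib)
  then have "(?s m oo fps_X ^ k) * inverse (?s m) = (inverse (?s m) * ?s m) * ?r"
    by (simp only: mult_ac)
  also have "\<dots> = ?r"
    unfolding inverse_mult_eq_1[OF s0] by (rule mult_1_left)
  finally have "(?s m oo fps_X ^ k) * inverse (?s m) = ?r" .
  moreover have "fps_nth ?r n \<ge> 0"
    by (intro fps_prod_nonneg)
      (auto simp: fps_sum_nth simp flip: power_mult power_Suc intro!: sum_nonneg)
  ultimately show "fps_nth ((?s m oo fps_X ^ k) * inverse (?s m)) n \<ge> 0"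
    by (simp only:)
qed

lemma h_nth_0: "fps_nth h 0 = 0"
proof -
  have "fps_nth (h_term (Suc n)) 0 = 0" for n
    unfolding h_term_def by (simp add: fps_divide_unit)
  moreover have "\<forall>\<^sub>F n in sequentially. fps_nth (\<Sum>i<n. h_term (Suc i)) 0 = fps_nth h 0"
    using h_sums unfolding sums_def tendsto_fps_iff by blast
  ultimately show ?thesis
    by (simp add: fps_sum_nth)
qed

lemma fps_compose_X_power_telescope:
  fixes f :: "'a::idom fps"
  assumes "p > 0"
  shows "f - of_nat p ^ m * (f oo fps_X ^ (p ^ m)) =
    (\<Sum>j<m. of_nat p ^ j * ((f - of_nat p * (f oo fps_X ^ p)) oo fps_X ^ (p ^ j)))"
proof (induction m)
  case (Suc m)
  have X0: "fps_nth (fps_X ^ k :: 'a fps) 0 = 0" if "k > 0" for k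
    using that by simp
  have compose_of_nat: "of_nat k oo c = of_nat k" for k and c :: "'a fps"
    by (simp flip: fps_of_nat)
  have step: "(f - of_nat p * (f oo fps_X ^ p)) oo fps_X ^ (p ^ m) =
      (f oo fps_X ^ (p ^ m)) - of_nat p * (f oo fps_X ^ (p ^ Suc m))"
    using assms
    by (simp add: fps_compose_sub_distrib fps_compose_mult_distrib X0 fps_compose_assoc[symmetric]
        fps_X_power_compose compose_of_nat mult.commute flip: power_mult)
  show ?case
    unfolding sum.lessThan_Suc step Suc.IH[symmetric] by (simp add: algebra_simps)
qed simp

text \<open>
  The substitution \<open>q \<mapsto> q\<^sup>k\<close> turns \<open>f/E\<close> into \<open>f(q\<^sup>k) / E(q\<^sup>k)\<close>; multiplication by the nonnegative
  series \<open>E(q\<^sup>k) / E(q)\<close> restores the denominator \<open>E(q)\<close>.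
\<close>

lemma inverse_qpochhammer_mult_compose_nonneg:
  assumes "k > 0" and "\<And>n. fps_nth (inverse (qpochhammer_inf fps_X) * f) n \<ge> 0"
  shows "fps_nth (inverse (qpochhammer_inf fps_X) * (f oo fps_X ^ k)) n \<ge> 0"
proof -
  let ?E = "qpochhammer_inf fps_X" and ?X = "fps_X ^ k :: real fps"
  have X0: "fps_nth ?X 0 = 0"
    using assms(1) by simp
  have "?E * (inverse ?E * f) = f"
    using inverse_mult_eq_1'[of ?E] by (simp add: qpochhammer_inf_X_nth_0 flip: mult.assoc)
  then have "f oo ?X = (?E oo ?X) * ((inverse ?E * f) oo ?X)"
    by (metis fps_compose_mult_distrib[OF X0])
  then have "inverse ?E * (f oo ?X) = ((?E oo ?X) * inverse ?E) * ((inverse ?E * f) oo ?X)"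
    by (simp only: mult_ac)
  then show ?thesis
    by (simp only: fps_mult_nonneg qpochhammer_quotient_nonneg[OF assms(1)]
        fps_compose_X_power_nonneg assms(2))
qed

theorem theorem1p2:
  fixes p :: nat
  assumes "prime p"
    and "\<And>n. n \<ge> 1 \<Longrightarrow>
           fps_nth (1 / qpochhammer_inf fps_X * (h - of_nat p * (h oo fps_X ^ p))) n > 0"
  shows "\<forall>m\<ge>2. \<forall>n\<ge>1.
           fps_nth (1 / qpochhammer_inf fps_X *
             (h - of_nat p ^ m * (h oo fps_X ^ (p ^ m)))) n > 0"
proof (intro allI impI)
  fix m n :: nat
  assume m: "m \<ge> 2" and n: "n \<ge> 1"
  let ?E = "qpochhammer_inf fps_X"
  define g where "g = h - of_nat p * (h oo fps_X ^ p)"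
  have p: "p > 0"
    using assms(1) by (rule prime_gt_0_nat)
  have inv: "1 / ?E = inverse ?E"
    by (simp add: fps_divide_unit qpochhammer_inf_X_nth_0)
  have pos: "fps_nth (inverse ?E * g) i > 0" if "i \<ge> 1" for i
    using assms(2)[OF that] by (simp add: inv g_def)
  have "fps_nth (inverse ?E * g) 0 = 0"
    by (simp add: g_def h_nth_0)
  with pos have nonneg: "fps_nth (inverse ?E * g) i \<ge> 0" for i
    by (cases i) (auto intro: less_imp_le)
  have "inverse ?E * (h - of_nat p ^ m * (h oo fps_X ^ (p ^ m))) =
      (\<Sum>j<m. of_nat (p ^ j) * (inverse ?E * (g oo fps_X ^ (p ^ j))))"
    unfolding fps_compose_X_power_telescope[OF p] g_def sum_distrib_left of_nat_power
    by (simp only: mult_ac)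
  then have "fps_nth (1 / ?E * (h - of_nat p ^ m * (h oo fps_X ^ (p ^ m)))) n =
      (\<Sum>j<m. of_nat (p ^ j) * fps_nth (inverse ?E * (g oo fps_X ^ (p ^ j))) n)"
    unfolding inv by (simp only: fps_sum_nth fps_mult_of_nat_nth)
  also have "\<dots> > 0"
  proof (rule sum_pos2)
    show "0 < of_nat (p ^ 0) * fps_nth (inverse ?E * (g oo fps_X ^ (p ^ 0))) n"
      using pos[OF n] by simp
    show "0 \<le> of_nat (p ^ j) * fps_nth (inverse ?E * (g oo fps_X ^ (p ^ j))) n" for j
      using p nonneg by (intro mult_nonneg_nonneg inverse_qpochhammer_mult_compose_nonneg) auto
  qed (use m in auto)
  finally show "fps_nth (1 / ?E * (h - of_nat p ^ m * (h oo fps_X ^ (p ^ m)))) n > 0" .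
qed

end
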